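(* Let $V=\{v_0,v_1,v_2\}$ be three non-collinear points in a real affine (Euclidean) plane $\Pi$, let $T=\mathrm{co}(V)$ be the triangle with vertex set $V$, and let $R_T$ be the circumradius of $T$. For $r\ge\frac12\max_{i<j}\lVert v_i-v_j\rVert_2$ let $\mathcal{C}^r_V=\mathcal{C}^r_0\cap\mathcal{C}^r_1\cap\mathcal{C}^r_2$ be the intersection of the three double circles of radius $r$. Then $\mathcal{C}^r_V=\emptyset$ if and only if $r\neq R_T$. For $r=R_T$, the set $\mathcal{C}^r_V$ is the union of the circumcircle of $T$ and of $\{O^*\}$, where $O^*$ is the orthocenter of $T$.
   Context: For $\{i,j,k\}=\{0,1,2\}$ and $r\ge\frac12\lVert v_i-v_j\rVert_2$, the double circle $\mathcal{C}^r_k\subset\Pi$ is the union of the two circles of radius $r$ in $\Pi$ passing through $v_i$ and $v_j$ (they reduce to a single circle when $r=\frac12\lVert v_i-v_j\rVert_2$). *)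

theory Defs
  imports "HOL-Analysis.Analysis"
begin

(* The plane is an arbitrary 2-dimensional affine subspace P of a Euclidean
   space; P = UNIV in dimension 2 is included. *)

definition plane_circle :: "'a::euclidean_space set \<Rightarrow> 'a \<Rightarrow> real \<Rightarrow> 'a set" where
  "plane_circle P c r = sphere c r \<inter> P"

(* For distinct a, b in P and 2 * r >= dist a b there are exactly two admissible
   centres c, which coincide when 2 * r = dist a b. *)
definition double_circle :: "'a::euclidean_space set \<Rightarrow> real \<Rightarrow> 'a \<Rightarrow> 'a \<Rightarrow> 'a set" where
  "double_circle P r a b =
     \<Union> {plane_circle P c r | c. c \<in> P \<and> a \<in> plane_circle P c r \<and> b \<in> plane_circle P c r}"

definition double_circle_inter ::
    "'a::euclidean_space set \<Rightarrow> real \<Rightarrow> 'a \<Rightarrow> 'a \<Rightarrow> 'a \<Rightarrow> 'a set" where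
  "double_circle_inter P r v0 v1 v2 =
     double_circle P r v1 v2 \<inter> double_circle P r v0 v2 \<inter> double_circle P r v0 v1"

(* The notions below are meant for nondegenerate triangles T, where affine hull T
   is the plane of T and the definite descriptions are well defined. *)

definition vertices :: "'a::euclidean_space set \<Rightarrow> 'a set" where
  "vertices T = {v. v extreme_point_of T}"

definition circumcenter :: "'a::euclidean_space set \<Rightarrow> 'a" where
  "circumcenter T =
     (THE c. c \<in> affine hull T \<and> (\<forall>a\<in>vertices T. \<forall>b\<in>vertices T. dist c a = dist c b))"

definition circumradius :: "'a::euclidean_space set \<Rightarrow> real" where
  "circumradius T = (THE R. \<forall>a\<in>vertices T. dist (circumcenter T) a = R)"

definition circumcircle :: "'a::euclidean_space set \<Rightarrow> 'a set" where
  "circumcircle T = plane_circle (affine hull T) (circumcenter T) (circumradius T)"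

(* The line in the plane of T through the vertex a perpendicular to the opposite side. *)
definition altitude :: "'a::euclidean_space set \<Rightarrow> 'a \<Rightarrow> 'a set" where
  "altitude T a =
     {p \<in> affine hull T. \<forall>b\<in>vertices T - {a}. \<forall>c\<in>vertices T - {a}. orthogonal (p - a) (b - c)}"

definition orthocenter :: "'a::euclidean_space set \<Rightarrow> 'a" where
  "orthocenter T = (THE p. \<forall>a\<in>vertices T. p \<in> altitude T a)"

end

theory Submission imports Defs begin

text \<open>
  Everything rests on one fact about the plane: two distinct circles of radius \<open>r\<close> that meet in
  two distinct points form, with their centres, a rhombus. If \<open>p\<close> and \<open>q\<close> are the centres and \<open>a\<close>
  and \<open>b\<close> the points, the diagonals of the rhombus bisect each other, so \<open>a + b = p + q\<close>
  (\<open>rhombus_in_plane\<close>).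

  Let \<open>x\<close> lie on all three double circles, and let \<open>c\<^sub>k\<close> be the centre of a circle of radius \<open>r\<close> through
  \<open>x\<close> and the two vertices other than \<open>v\<^sub>k\<close>. If two of the centres coincide, or if \<open>x\<close> is a vertex,
  some circle of radius \<open>r\<close> passes through all three vertices, so \<open>r\<close> is the circumradius. Otherwise
  the circles centred at \<open>c\<^sub>i\<close> and \<open>c\<^sub>j\<close> meet in \<open>x\<close> and \<open>v\<^sub>k\<close>, so \<open>v\<^sub>k = c\<^sub>i + c\<^sub>j - x\<close>. Then the point
  \<open>c\<^sub>0 + c\<^sub>1 + c\<^sub>2 - 2x\<close> differs from \<open>v\<^sub>k\<close> by \<open>c\<^sub>k - x\<close>, a vector of length \<open>r\<close>, for every \<open>k\<close>, and
  \<open>r\<close> is again the circumradius (\<open>ex_circle_through_vertices_if_common_point\<close>). This is Johnson's theorem on three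
  circles of equal radius through a point.

  Now let \<open>r\<close> be the circumradius and \<open>c\<close> the circumcentre. By the rhombus fact again, the two circles of
  radius \<open>r\<close> through \<open>v\<^sub>i\<close> and \<open>v\<^sub>j\<close> have centres \<open>c\<close> and \<open>v\<^sub>i + v\<^sub>j - c\<close>: the second circle is the
  circumcircle reflected in a side. A point on all three double circles lies on the circumcircle or on
  all three reflected circles. The point \<open>h = v\<^sub>0 + v\<^sub>1 + v\<^sub>2 - 2c\<close> is on the reflected circles because
  its difference from the centre \<open>v\<^sub>i + v\<^sub>j - c\<close> is \<open>v\<^sub>k - c\<close>. It is the only such point,
  because the three reflected centres form the image of the triangle under a point reflection and
  hence are not collinear
  (\<open>double_circle_inter_at_circumradius\<close>). Finally, \<open>h\<close> is the orthocentre: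
  \<open>(h - v\<^sub>k) \<bullet> (v\<^sub>i - v\<^sub>j) = (v\<^sub>i + v\<^sub>j - 2c) \<bullet> (v\<^sub>i - v\<^sub>j) = |v\<^sub>i - c|\<^sup>2 - |v\<^sub>j - c|\<^sup>2 = 0\<close>.
\<close>

section \<open>Circles of equal radius in a plane\<close>

lemma pairwise_orthogonal_triple_in_plane:
  fixes x y z :: "'a::euclidean_space"
  assumes "dim S \<le> 2" "x \<in> S" "y \<in> S" "z \<in> S"
    and "orthogonal x y" "orthogonal x z" "orthogonal y z"
  shows "x = 0 \<or> y = 0 \<or> z = 0"
proof (rule ccontr)
  assume nz: "\<not> ?thesis"
  then have "x \<noteq> y" "x \<noteq> z" "y \<noteq> z"
    using assms(5-7) by (auto simp: orthogonal_def)
  then have card: "card {x, y, z} = 3"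
    by auto
  have "pairwise orthogonal {x, y, z}"
    using assms(5-7) by (auto simp: pairwise_def orthogonal_commute)
  then have "independent {x, y, z}"
    using nz by (intro pairwise_orthogonal_independent) auto
  then have "card {x, y, z} \<le> dim S"
    using assms(2-4) by (intro independent_card_le_dim) auto
  then show False
    using card assms(1) by simp
qed

text \<open>
  The segments \<open>ab\<close> and \<open>pq\<close> are perpendicular, and both are perpendicular to the vector between
  their midpoints, because each of \<open>p\<close>, \<open>q\<close> is equidistant from \<open>a\<close> and \<open>b\<close> and vice versa. The
  direction space of the plane has no room for three nonzero pairwise orthogonal vectors, so one of
  them vanishes.
\<close>

lemma rhombus_in_plane:
  fixes a b p q :: "'a::euclidean_space"
  assumes P: "affine P" "aff_dim P = 2" and mem: "a \<in> P" "b \<in> P" "p \<in> P" "q \<in> P"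
    and d: "dist p a = r" "dist p b = r" "dist q a = r" "dist q b = r"
  shows "a = b \<or> p = q \<or> a + b = p + q"
proof -
  let ?D = "(\<lambda>x. x - p) ` P"
  have D: "subspace ?D"
    using P mem by (intro affine_diffs_subspace_subtract)
  have "int (dim ?D) = 2"
    using aff_dim_dim_affine_diffs[OF P(1) mem(3)] P(2) by linarith
  then have dim: "dim ?D \<le> 2" by simp
  have "a - p \<in> ?D" "b - p \<in> ?D" "q - p \<in> ?D"
    using mem by auto
  then have "a - b \<in> ?D" "p - q \<in> ?D" "a + b - (p + q) \<in> ?D"
    using D subspace_diff[of ?D "a - p" "b - p"] subspace_neg[of ?D "q - p"]
      subspace_diff[of ?D "(a - p) + (b - p)" "q - p"] subspace_add[of ?D "a - p" "b - p"]
    by (auto simp: algebra_simps)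
  moreover have sq: "(p - a) \<bullet> (p - a) = r\<^sup>2" "(p - b) \<bullet> (p - b) = r\<^sup>2"
      "(q - a) \<bullet> (q - a) = r\<^sup>2" "(q - b) \<bullet> (q - b) = r\<^sup>2"
    using d by (auto simp: dist_norm power2_norm_eq_inner[symmetric])
  have "orthogonal (a - b) (p - q)" "orthogonal (a - b) (a + b - (p + q))"
      "orthogonal (p - q) (a + b - (p + q))"
    using sq by (auto simp: orthogonal_def inner_commute algebra_simps)
  ultimately have "a - b = 0 \<or> p - q = 0 \<or> a + b - (p + q) = 0"
    using dim pairwise_orthogonal_triple_in_plane by blast
  then show ?thesis by simp
qed

section \<open>Points determined by distances and directions in an affine hull\<close>

text \<open>
  The function \<open>z \<mapsto> (x - y) \<bullet> z\<close> is constant on \<open>S\<close>, hence on its affine hull, which contains \<open>x\<close> and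
  \<open>y\<close>; so \<open>x - y\<close> is orthogonal to itself. The uniqueness of the
  circumcentre, of the orthocentre and of the common point of the reflected circles all come from here.
\<close>

lemma eq_if_orthogonal_to_differences:
  fixes x y :: "'a::euclidean_space"
  assumes "x \<in> affine hull S" "y \<in> affine hull S"
    and "\<And>a b. a \<in> S \<Longrightarrow> b \<in> S \<Longrightarrow> (x - y) \<bullet> (a - b) = 0"
  shows "x = y"
proof -
  obtain s where s: "s \<in> S"
    using assms(1) by fastforce
  have "affine {z. (x - y) \<bullet> z = (x - y) \<bullet> s}"
    by (rule affine_hyperplane)
  then have "affine hull S \<subseteq> {z. (x - y) \<bullet> z = (x - y) \<bullet> s}"
    using assms(3)[OF _ s] by (intro hull_minimal) (auto simp: inner_diff_right)
  then have "(x - y) \<bullet> x = (x - y) \<bullet> s" "(x - y) \<bullet> y = (x - y) \<bullet> s"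
    using assms(1,2) by blast+
  then have "(x - y) \<bullet> (x - y) = 0"
    by (simp add: inner_diff_right)
  then show ?thesis by simp
qed

text \<open>
  The equation of the perpendicular bisector of \<open>a\<close> and \<open>b\<close>. It is linear in \<open>c\<close>, so the difference
  of two solutions is orthogonal to \<open>a - b\<close>.
\<close>

lemma dist_eq_iff_inner:
  fixes c a b :: "'a::real_inner"
  shows "dist c a = dist c b \<longleftrightarrow> 2 * (c \<bullet> (a - b)) = a \<bullet> a - b \<bullet> b"
proof -
  have "dist c a = dist c b \<longleftrightarrow> (c - a) \<bullet> (c - a) = (c - b) \<bullet> (c - b)"
    by (simp add: dist_norm norm_eq)
  then show ?thesis
    by (auto simp: inner_commute algebra_simps)
qed

lemma eq_if_equidistant:
  fixes x y :: "'a::euclidean_space"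
  assumes "x \<in> affine hull S" "y \<in> affine hull S"
    and "\<And>a b. a \<in> S \<Longrightarrow> b \<in> S \<Longrightarrow> dist x a = dist x b"
    and "\<And>a b. a \<in> S \<Longrightarrow> b \<in> S \<Longrightarrow> dist y a = dist y b"
  shows "x = y"
proof (rule eq_if_orthogonal_to_differences[OF assms(1,2)])
  fix a b assume "a \<in> S" "b \<in> S"
  then show "(x - y) \<bullet> (a - b) = 0"
    using assms(3,4)[of a b] by (simp add: dist_eq_iff_inner inner_diff_left)
qed

text \<open>
  With \<open>u = v1 - v0\<close> and \<open>w = v2 - v0\<close>, the centre \<open>v0 + s u + t w\<close> is found by Cramer's rule from the
  linear system \<open>2 (s u + t w) \<bullet> u = u \<bullet> u\<close>, \<open>2 (s u + t w) \<bullet> w = w \<bullet> w\<close>. Its determinant is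
  a multiple of the Gram determinant \<open>G\<close> of \<open>u\<close> and \<open>w\<close>, which is positive by the strict
  Cauchy-Schwarz inequality.
\<close>

lemma ex_circumcenter:
  fixes v0 v1 v2 :: "'a::euclidean_space"
  assumes "\<not> collinear {v0, v1, v2}"
  obtains c where "c \<in> affine hull {v0, v1, v2}" "dist c v0 = dist c v1" "dist c v0 = dist c v2"
proof -
  define u w where "u = v1 - v0" and "w = v2 - v0"
  define G where "G = (u \<bullet> u) * (w \<bullet> w) - (u \<bullet> w)\<^sup>2"
  have "\<not> collinear {0, u, w}"
    using assms collinear_3[of v1 v0 v2] by (simp add: u_def w_def insert_commute)
  then have "\<bar>u \<bullet> w\<bar> \<noteq> norm u * norm w"
    by (simp add: norm_cauchy_schwarz_equal)
  then have "\<bar>u \<bullet> w\<bar> < norm u * norm w"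
    using Cauchy_Schwarz_ineq2[of u w] by simp
  then have "\<bar>u \<bullet> w\<bar>\<^sup>2 < (norm u * norm w)\<^sup>2"
    by (intro power_strict_mono) auto
  then have G: "G > 0"
    by (simp add: G_def power_mult_distrib power2_norm_eq_inner)
  define s t where "s = (w \<bullet> w) * (u \<bullet> u - u \<bullet> w) / (2 * G)"
    and "t = (u \<bullet> u) * (w \<bullet> w - u \<bullet> w) / (2 * G)"
  define x where "x = s *\<^sub>R u + t *\<^sub>R w"
  have "(w \<bullet> w) * (u \<bullet> u - u \<bullet> w) * (u \<bullet> u) + (u \<bullet> u) * (w \<bullet> w - u \<bullet> w) * (u \<bullet> w) = (u \<bullet> u) * G"
    "(w \<bullet> w) * (u \<bullet> u - u \<bullet> w) * (u \<bullet> w) + (u \<bullet> u) * (w \<bullet> w - u \<bullet> w) * (w \<bullet> w) = (w \<bullet> w) * G"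
    by (simp_all add: G_def algebra_simps power2_eq_square)
  then have "x \<bullet> u = (u \<bullet> u) * G / (2 * G)" "x \<bullet> w = (w \<bullet> w) * G / (2 * G)"
    unfolding x_def s_def t_def inner_add_left inner_scaleR_left inner_commute[of w u]
      times_divide_eq_left add_divide_distrib[symmetric] by (simp_all only:)
  then have "2 * (x \<bullet> u) = u \<bullet> u" "2 * (x \<bullet> w) = w \<bullet> w"
    using G by auto
  then have "dist (v0 + x) v0 = dist (v0 + x) v1" "dist (v0 + x) v0 = dist (v0 + x) v2"
    by (simp_all add: dist_eq_iff_inner u_def w_def inner_commute algebra_simps)
  moreover have "v0 + x \<in> affine hull {v0, v1, v2}"
  proof -
    have "(1 - s - t) *\<^sub>R v0 + s *\<^sub>R v1 + t *\<^sub>R v2 \<in> affine hull {v0, v1, v2}"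
      by (rule mem_affine_3) (auto simp: hull_inc)
    moreover have "v0 + x = (1 - s - t) *\<^sub>R v0 + s *\<^sub>R v1 + t *\<^sub>R v2"
      by (simp add: x_def u_def w_def algebra_simps)
    ultimately show ?thesis
      by (simp only:)
  qed
  ultimately show ?thesis
    using that by blast
qed

section \<open>Common points of the double circles\<close>

lemma mem_plane_circle: "x \<in> plane_circle P c r \<longleftrightarrow> x \<in> P \<and> dist c x = r"
  by (auto simp: plane_circle_def)

lemma mem_double_circle:
  assumes "a \<in> P" "b \<in> P"
  shows "x \<in> double_circle P r a b \<longleftrightarrow>
    x \<in> P \<and> (\<exists>c\<in>P. dist c a = r \<and> dist c b = r \<and> dist c x = r)"
  using assms by (auto simp: double_circle_def mem_plane_circle)

lemma affine_add_diff_mem: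
  fixes a b c :: "'a::real_vector"
  assumes "affine P" "a \<in> P" "b \<in> P" "c \<in> P"
  shows "a + b - c \<in> P"
  using mem_affine_3[OF assms, of 1 1 "-1"] by simp

text \<open>
  The rhombus fact read as a statement about centres: besides the circle centred at \<open>c\<close>, only its
  reflection in the line \<open>ab\<close> has radius \<open>r\<close> and passes through \<open>a\<close> and \<open>b\<close>.
\<close>

lemma circle_center_cases:
  fixes a b :: "'a::euclidean_space"
  assumes "affine P" "aff_dim P = 2" "a \<in> P" "b \<in> P" "c \<in> P" "d \<in> P" "a \<noteq> b"
    and "dist c a = r" "dist c b = r" "dist d a = r" "dist d b = r"
  shows "d = c \<or> d = a + b - c"
  using rhombus_in_plane[of P a b c d r] assms by (auto simp: algebra_simps)

text \<open>
  Johnson's theorem: circles of radius \<open>r\<close> through a common point meet again in three points that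
  lie on a circle of radius \<open>r\<close>. The degenerate configurations have a circle through all
  three vertices among the given ones.
\<close>

lemma ex_circle_through_vertices_if_common_point:
  fixes v0 v1 v2 :: "'a::euclidean_space"
  assumes P: "affine P" "aff_dim P = 2" and v: "v0 \<in> P" "v1 \<in> P" "v2 \<in> P"
    and x: "x \<in> double_circle_inter P r v0 v1 v2"
  shows "\<exists>c\<in>P. dist c v0 = r \<and> dist c v1 = r \<and> dist c v2 = r"
proof -
  obtain c0 c1 c2 where xP: "x \<in> P" and cP: "c0 \<in> P" "c1 \<in> P" "c2 \<in> P"
    and c0: "dist c0 v1 = r" "dist c0 v2 = r" "dist c0 x = r"
    and c1: "dist c1 v0 = r" "dist c1 v2 = r" "dist c1 x = r"
    and c2: "dist c2 v0 = r" "dist c2 v1 = r" "dist c2 x = r"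
    using x v unfolding double_circle_inter_def by (auto simp: mem_double_circle)
  show ?thesis
  proof (cases "c0 = c1 \<or> c0 = c2 \<or> c1 = c2 \<or> x = v0 \<or> x = v1 \<or> x = v2")
    case True
    then show ?thesis
      using cP c0 c1 c2 by metis
  next
    case False
    then have e: "v0 = c1 + c2 - x" "v1 = c0 + c2 - x" "v2 = c0 + c1 - x"
      using rhombus_in_plane[OF P v(1) xP cP(2,3) c1(1,3) c2(1,3)]
        rhombus_in_plane[OF P v(2) xP cP(1,3) c0(1,3) c2(2,3)]
        rhombus_in_plane[OF P v(3) xP cP(1,2) c0(2,3) c1(2,3)]
      by (auto simp: algebra_simps)
    (* v0 v1 v2 is the image of c0 c1 c2 under the point reflection z |-> c0 + c1 + c2 - x - z;
       N is the image of x, and x is the centre of the circle of radius r through c0, c1, c2. *)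
    define N where "N = (c0 + c1 - x) + c2 - x"
    have "N \<in> P"
      unfolding N_def using P(1) cP xP by (intro affine_add_diff_mem)
    moreover have "N - v0 = c0 - x" "N - v1 = c1 - x" "N - v2 = c2 - x"
      by (auto simp: e N_def)
    ultimately show ?thesis
      using c0(3) c1(3) c2(3) by (metis dist_norm)
  qed
qed

text \<open>
  The circumcircle has radius \<open>R\<close> and passes through every pair of vertices, so each double circle is
  the union of the circumcircle and its reflection in a side. A common point off the circumcircle is thus at distance \<open>R\<close>
  from all three reflected centres, and a point of the plane is determined by being equidistant
  from them.
\<close>

lemma double_circle_inter_at_circumradius:
  fixes v0 v1 v2 c :: "'a::euclidean_space"
  assumes P: "affine P" "aff_dim P = 2" "affine hull {v0, v1, v2} = P"
    and nc: "\<not> collinear {v0, v1, v2}"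
    and c: "c \<in> P" "dist c v0 = R" "dist c v1 = R" "dist c v2 = R"
  shows "double_circle_inter P R v0 v1 v2 = plane_circle P c R \<union> {(v0 + v1 - c) + v2 - c}"
    (is "_ = _ \<union> {?h}")
proof -
  have v: "v0 \<in> P" "v1 \<in> P" "v2 \<in> P"
    using P(3) by (metis hull_inc insertCI)+
  have ne: "v1 \<noteq> v2" "v0 \<noteq> v2" "v0 \<noteq> v1"
    using nc by (auto simp: insert_commute)
  have hP: "?h \<in> P"
    using P(1) v c(1) by (intro affine_add_diff_mem)
  have cP: "v1 + v2 - c \<in> P" "v0 + v2 - c \<in> P" "v0 + v1 - c \<in> P"
    using P(1) v c(1) by (auto intro: affine_add_diff_mem)
  have n: "norm (v0 - c) = R" "norm (v1 - c) = R" "norm (v2 - c) = R"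
    using c by (auto simp: dist_norm norm_minus_commute)
  have refl: "dist (v1 + v2 - c) v1 = R" "dist (v1 + v2 - c) v2 = R"
    "dist (v0 + v2 - c) v0 = R" "dist (v0 + v2 - c) v2 = R"
    "dist (v0 + v1 - c) v0 = R" "dist (v0 + v1 - c) v1 = R"
    using n by (simp_all add: dist_norm algebra_simps)
  have "?h - (v1 + v2 - c) = v0 - c" "?h - (v0 + v2 - c) = v1 - c" "?h - (v0 + v1 - c) = v2 - c"
    by (simp_all add: algebra_simps)
  then have h: "dist (v1 + v2 - c) ?h = R" "dist (v0 + v2 - c) ?h = R" "dist (v0 + v1 - c) ?h = R"
    using n by (metis dist_commute dist_norm)+
  show ?thesis
  proof (intro equalityI subsetI)
    fix x assume "x \<in> double_circle_inter P R v0 v1 v2"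
    then obtain c0 c1 c2 where xP: "x \<in> P" and cs: "c0 \<in> P" "c1 \<in> P" "c2 \<in> P"
      and c0: "dist c0 v1 = R" "dist c0 v2 = R" "dist c0 x = R"
      and c1: "dist c1 v0 = R" "dist c1 v2 = R" "dist c1 x = R"
      and c2: "dist c2 v0 = R" "dist c2 v1 = R" "dist c2 x = R"
      using v unfolding double_circle_inter_def by (auto simp: mem_double_circle)
    have alt: "c0 = c \<or> c0 = v1 + v2 - c" "c1 = c \<or> c1 = v0 + v2 - c" "c2 = c \<or> c2 = v0 + v1 - c"
      using circle_center_cases[OF P(1,2) v(2,3) c(1) cs(1) ne(1) c(3,4) c0(1,2)]
        circle_center_cases[OF P(1,2) v(1,3) c(1) cs(2) ne(2) c(2,4) c1(1,2)]
        circle_center_cases[OF P(1,2) v(1,2) c(1) cs(3) ne(3) c(2,3) c2(1,2)]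
      by auto
    show "x \<in> plane_circle P c R \<union> {?h}"
    proof (cases "c0 = c \<or> c1 = c \<or> c2 = c")
      case True
      then show ?thesis
        using xP c0 c1 c2 by (auto simp: mem_plane_circle)
    next
      case False
      with alt have e: "c0 = v1 + v2 - c" "c1 = v0 + v2 - c" "c2 = v0 + v1 - c"
        by auto
      (* The reflected centres have the same differences as the vertices, up to sign, so x - h is
         orthogonal to the sides of the triangle. *)
      have "dist x c0 = dist x c1" "dist x c0 = dist x c2"
        "dist ?h c0 = dist ?h c1" "dist ?h c0 = dist ?h c2"
        using c0 c1 c2 h by (simp_all add: e dist_commute)
      then have "2 * ((x - ?h) \<bullet> (c0 - c1)) = 0" "2 * ((x - ?h) \<bullet> (c0 - c2)) = 0"
        unfolding dist_eq_iff_inner by (simp_all only: inner_diff_left right_diff_distrib diff_self)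
      moreover have "c0 - c1 = v1 - v0" "c0 - c2 = v2 - v0"
        by (simp_all add: e)
      ultimately have eq: "(x - ?h) \<bullet> v1 = (x - ?h) \<bullet> v0" "(x - ?h) \<bullet> v2 = (x - ?h) \<bullet> v0"
        by (simp_all only: inner_diff_right) auto
      have "x = ?h"
        using xP hP eq unfolding P(3)[symmetric]
        by (intro eq_if_orthogonal_to_differences[of x "{v0, v1, v2}"])
          (auto simp only: insert_iff empty_iff inner_diff_right)
      then show ?thesis by simp
    qed
  next
    fix x assume "x \<in> plane_circle P c R \<union> {?h}"
    then show "x \<in> double_circle_inter P R v0 v1 v2"
    proof
      assume "x \<in> plane_circle P c R"
      then show ?thesis
        using c v by (auto simp: double_circle_inter_def mem_double_circle mem_plane_circle)
    next
      assume "x \<in> {?h}"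
      then have "x = ?h" by simp
      then show ?thesis
        unfolding double_circle_inter_def using v hP cP refl h
        by (simp only: Int_iff mem_double_circle) blast
    qed
  qed
qed

section \<open>The centres of a triangle\<close>

lemma vertices_triangle:
  fixes v0 v1 v2 :: "'a::euclidean_space"
  assumes "\<not> collinear {v0, v1, v2}"
  shows "vertices (convex hull {v0, v1, v2}) = {v0, v1, v2}"
proof -
  have "\<not> affine_dependent {v0, v1, v2}"
    using assms by (auto simp: collinear_3_eq_affine_dependent)
  then show ?thesis
    unfolding vertices_def by (auto simp: extreme_point_of_convex_hull_affine_independent)
qed

text \<open>
  The classical relation between the centres: taking the circumcentre as origin, the orthocentre is the sum of the
  vertices.
\<close>

lemma triangle_centers:
  fixes v0 v1 v2 c :: "'a::euclidean_space"
  assumes nc: "\<not> collinear {v0, v1, v2}"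
    and c: "c \<in> affine hull {v0, v1, v2}" "dist c v0 = R" "dist c v1 = R" "dist c v2 = R"
  shows circumcenter_eq: "circumcenter (convex hull {v0, v1, v2}) = c"
    and circumradius_eq: "circumradius (convex hull {v0, v1, v2}) = R"
    and orthocenter_eq: "orthocenter (convex hull {v0, v1, v2}) = (v0 + v1 - c) + v2 - c"
proof -
  let ?T = "convex hull {v0, v1, v2}"
  note V = vertices_triangle[OF nc] affine_hull_convex_hull[of "{v0, v1, v2}"]
  show cc: "circumcenter ?T = c"
    unfolding circumcenter_def V
  proof (rule the_equality)
    show "c \<in> affine hull {v0, v1, v2} \<and>
        (\<forall>a\<in>{v0, v1, v2}. \<forall>b\<in>{v0, v1, v2}. dist c a = dist c b)"
      using c by auto
    then show "d = c" if "d \<in> affine hull {v0, v1, v2} \<and>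
        (\<forall>a\<in>{v0, v1, v2}. \<forall>b\<in>{v0, v1, v2}. dist d a = dist d b)" for d
      using that eq_if_equidistant[of d "{v0, v1, v2}" c] by metis
  qed
  show "circumradius ?T = R"
    unfolding circumradius_def cc V by (rule the_equality) (use c in auto)
  let ?h = "(v0 + v1 - c) + v2 - c"
  have ne: "v1 \<noteq> v2" "v0 \<noteq> v2" "v0 \<noteq> v1"
    using nc by (auto simp: insert_commute)
  have hP: "?h \<in> affine hull {v0, v1, v2}"
    using c(1) by (intro affine_add_diff_mem affine_affine_hull) (auto simp: hull_inc)
  (* Each of the orthogonality relations for h is the statement that c lies on the perpendicular
     bisector of the side. *)
  have "2 * (c \<bullet> (v0 - v1)) = v0 \<bullet> v0 - v1 \<bullet> v1" "2 * (c \<bullet> (v0 - v2)) = v0 \<bullet> v0 - v2 \<bullet> v2"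
    "2 * (c \<bullet> (v1 - v2)) = v1 \<bullet> v1 - v2 \<bullet> v2"
    using c by (simp_all add: dist_eq_iff_inner[symmetric])
  then have h: "(?h - v0) \<bullet> (v1 - v2) = 0" "(?h - v1) \<bullet> (v0 - v2) = 0" "(?h - v2) \<bullet> (v0 - v1) = 0"
    by (simp_all add: inner_commute algebra_simps)
  have alt: "(\<forall>a\<in>vertices ?T. p \<in> altitude ?T a) \<longleftrightarrow> p \<in> affine hull {v0, v1, v2} \<and>
      (p - v0) \<bullet> (v1 - v2) = 0 \<and> (p - v1) \<bullet> (v0 - v2) = 0 \<and> (p - v2) \<bullet> (v0 - v1) = 0" for p
    using ne ne[symmetric] unfolding altitude_def V
    by (auto simp: orthogonal_def inner_diff_right)
  show "orthocenter ?T = ?h"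
    unfolding orthocenter_def alt
  proof (rule the_equality)
    fix p assume p: "p \<in> affine hull {v0, v1, v2} \<and>
      (p - v0) \<bullet> (v1 - v2) = 0 \<and> (p - v1) \<bullet> (v0 - v2) = 0 \<and> (p - v2) \<bullet> (v0 - v1) = 0"
    have "(p - ?h) \<bullet> (v1 - v2) = 0" "(p - ?h) \<bullet> (v0 - v2) = 0"
      using p h by (simp_all only: inner_diff_left) linarith+
    then show "p = ?h"
      using p hP
      by (intro eq_if_orthogonal_to_differences[of p "{v0, v1, v2}"])
        (auto simp only: insert_iff empty_iff inner_diff_right)
  qed (use hP h in simp)
qed

theorem proposition4:
  fixes P T :: "'a::euclidean_space set" and v0 v1 v2 :: 'a and r :: real
  assumes "affine P" and "aff_dim P = 2"
    and "v0 \<in> P" and "v1 \<in> P" and "v2 \<in> P"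
    and "\<not> collinear {v0, v1, v2}"
    and "T = convex hull {v0, v1, v2}"
    and "r \<ge> Max {dist v0 v1, dist v0 v2, dist v1 v2} / 2"
  shows "(double_circle_inter P r v0 v1 v2 = {} \<longleftrightarrow> r \<noteq> circumradius T) \<and>
         (r = circumradius T \<longrightarrow>
            double_circle_inter P r v0 v1 v2 = circumcircle T \<union> {orthocenter T})"
proof -
  note P = assms(1,2) and v = assms(3-5) and nc = assms(6)
  have "\<not> affine_dependent {v0, v1, v2}" "card {v0, v1, v2} = 3"
    using nc by (auto simp: collinear_3_eq_affine_dependent insert_commute)
  then have "aff_dim {v0, v1, v2} = 2"
    using aff_dim_affine_independent[of "{v0, v1, v2}"] by simp
  moreover have "affine hull {v0, v1, v2} \<subseteq> P"
    using P(1) v by (intro hull_minimal) auto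
  ultimately have hull: "affine hull {v0, v1, v2} = P"
    using P by (intro affine_dim_equal affine_affine_hull) auto
  have radius: "circumradius T = R"
    if "c \<in> P" "dist c v0 = R" "dist c v1 = R" "dist c v2 = R" for c R
    using circumradius_eq[OF nc, of c R] that assms(7) hull by simp
  obtain c where c: "c \<in> P" "dist c v0 = dist c v1" "dist c v0 = dist c v2"
    using ex_circumcenter[OF nc] hull by metis
  define R where "R = dist c v0"
  have cR: "c \<in> P" "dist c v0 = R" "dist c v1 = R" "dist c v2 = R"
    using c by (auto simp: R_def)
  have at_R: "double_circle_inter P R v0 v1 v2 = circumcircle T \<union> {orthocenter T}"
    using double_circle_inter_at_circumradius[OF P hull nc cR]
      triangle_centers[OF nc cR[folded hull]]
    by (simp only: circumcircle_def assms(7) affine_hull_convex_hull hull)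
  have "r = circumradius T" if "double_circle_inter P r v0 v1 v2 \<noteq> {}"
  proof -
    obtain x where "x \<in> double_circle_inter P r v0 v1 v2"
      using \<open>double_circle_inter P r v0 v1 v2 \<noteq> {}\<close> by blast
    from ex_circle_through_vertices_if_common_point[OF P v this] show ?thesis
      using radius by metis
  qed
  moreover have "circumradius T = R"
    by (rule radius[OF cR])
  ultimately show ?thesis
    using at_R by (metis Un_empty insert_not_empty)
qed

end
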